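(* Let $X_{\mathbf{a},\mathbf{b}}$ be a mixed Pham-Brieskorn surface germ at the origin (with its type as defined in the context). (1) If $X_{\mathbf{a},\mathbf{b}}$ is of type (2) or (5), then it is Lipschitz normally embedded. (2) If $X_{\mathbf{a},\mathbf{b}}$ is of type (3), then it is Lipschitz normally embedded. (3) If $X_{\mathbf{a},\mathbf{b}}$ is of type (4) with $a_2=1$, then it is Lipschitz normally embedded. (4) If $X_{\mathbf{a},\mathbf{b}}$ is of type (4) with $a_2\ge 2$, then it is not Lipschitz normally embedded. (5) If $X_{\mathbf{a},\mathbf{b}}$ is of type (1) and $a_1+2b_1$ is an even number, then it is not Lipschitz normally embedded.
   Context: For integers $0\le a_1\le a_2$, $a_2\ge 1$, $b_1,b_2\ge 0$ (with $b_1\ge 1$ if $a_1=0$), put $f_{\mathbf{a},\mathbf{b}}(z_1,z_2)=z_1^{a_1+b_1}\overline{z}_1^{\,b_1}+z_2^{a_2+b_2}\overline{z}_2^{\,b_2}$; the mixed Pham-Brieskorn surface is the germ at $0$ of $X_{\mathbf{a},\mathbf{b}}=f_{\mathbf{a},\mathbf{b}}^{-1}(0)\subset\mathbb{C}^2=\mathbb{R}^4$, and $\mu_{\mathbf{a},\mathbf{b}}=\frac{a_2+2b_2}{a_1+2b_1}$. Types: (1) $a_1\ge1$, $\mu_{\mathbf{a},\mathbf{b}}>1$; (2) $a_1\ge1$, $\mu_{\mathbf{a},\mathbf{b}}=1$; (3) $a_1=0$, $\mu_{\mathbf{a},\mathbf{b}}>1$; (4) $a_1=0$, $\mu_{\mathbf{a},\mathbf{b}}<1$;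 (5) $a_1=0$, $\mu_{\mathbf{a},\mathbf{b}}=1$. Standing assumptions: the cases $(a_1,b_1)=(1,0)$ and $(a_2,b_2)=(1,0)$ are excluded, and for surfaces of type (1) one assumes $\gcd(a_1,a_2)=1$. The outer metric on a germ $X\subset\mathbb{R}^m$ is $d_o(x,y)=\|x-y\|$; the inner metric $d_i(x,y)$ is the infimum of lengths of rectifiable arcs in $X$ joining $x$ and $y$. The germ $(X,0)$ is Lipschitz normally embedded if, in some neighbourhood of $0$, there is $C>0$ with $d_i(x,y)\le C\,d_o(x,y)$ for all $x,y\in X$. *)

theory Defs
  imports "HOL-Analysis.Analysis"
begin

(* Supremum of the lengths of inscribed polygons with vertices at
   parameters t 0 \<le> t 1 \<le> ... \<le> t n in [0,1]. *)
definition curve_length :: "(real \<Rightarrow> 'a::metric_space) \<Rightarrow> ennreal" where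
  "curve_length g =
     (SUP (n, t) \<in> {(n :: nat, t :: nat \<Rightarrow> real). mono t \<and> range t \<subseteq> {0..1}}.
        ennreal (\<Sum>i<n. dist (g (t i)) (g (t (Suc i)))))"

definition rectifiable :: "(real \<Rightarrow> 'a::metric_space) \<Rightarrow> bool" where
  "rectifiable g \<longleftrightarrow> path g \<and> curve_length g < \<infinity>"

(* The value is \<infinity> if no rectifiable path in X joins x and y. Paths need not be injective,
   so that constant paths give inner_dist X x x = 0 for x in X. *)
definition inner_dist :: "'a::metric_space set \<Rightarrow> 'a \<Rightarrow> 'a \<Rightarrow> ennreal" where
  "inner_dist X x y =
     (INF g \<in> {g. rectifiable g \<and> path_image g \<subseteq> X \<and> pathstart g = x \<and> pathfinish g = y}.
        curve_length g)"

(* Only the endpoints x, y are confined to the neighbourhood U, the arcs defining the inner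
   distance may run in all of X. The property still depends only on the germ of X at p: if x, y
   are close to p, an arc of length at most 2 * C * dist x y joining them stays close to p. *)
definition lipschitz_normally_embedded_at :: "'a::metric_space set \<Rightarrow> 'a \<Rightarrow> bool" where
  "lipschitz_normally_embedded_at X p \<longleftrightarrow>
     (\<exists>U C. open U \<and> p \<in> U \<and> C > 0 \<and>
        (\<forall>x \<in> X \<inter> U. \<forall>y \<in> X \<inter> U. inner_dist X x y \<le> ennreal (C * dist x y)))"

(* The product metric on complex \<times> complex is the Euclidean metric of R^4. *)
definition mixed_pb :: "nat \<Rightarrow> nat \<Rightarrow> nat \<Rightarrow> nat \<Rightarrow> complex \<times> complex \<Rightarrow> complex" where
  "mixed_pb a1 a2 b1 b2 z =
     fst z ^ (a1 + b1) * cnj (fst z) ^ b1 + snd z ^ (a2 + b2) * cnj (snd z) ^ b2"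

definition mixed_pb_surface :: "nat \<Rightarrow> nat \<Rightarrow> nat \<Rightarrow> nat \<Rightarrow> (complex \<times> complex) set" where
  "mixed_pb_surface a1 a2 b1 b2 = {z. mixed_pb a1 a2 b1 b2 z = 0}"

definition pb_mu :: "nat \<Rightarrow> nat \<Rightarrow> nat \<Rightarrow> nat \<Rightarrow> real" where
  "pb_mu a1 a2 b1 b2 = real (a2 + 2 * b2) / real (a1 + 2 * b1)"

definition pb_type1 :: "nat \<Rightarrow> nat \<Rightarrow> nat \<Rightarrow> nat \<Rightarrow> bool" where
  "pb_type1 a1 a2 b1 b2 \<longleftrightarrow> a1 \<ge> 1 \<and> pb_mu a1 a2 b1 b2 > 1"

definition pb_type2 :: "nat \<Rightarrow> nat \<Rightarrow> nat \<Rightarrow> nat \<Rightarrow> bool" where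
  "pb_type2 a1 a2 b1 b2 \<longleftrightarrow> a1 \<ge> 1 \<and> pb_mu a1 a2 b1 b2 = 1"

definition pb_type3 :: "nat \<Rightarrow> nat \<Rightarrow> nat \<Rightarrow> nat \<Rightarrow> bool" where
  "pb_type3 a1 a2 b1 b2 \<longleftrightarrow> a1 = 0 \<and> pb_mu a1 a2 b1 b2 > 1"

definition pb_type4 :: "nat \<Rightarrow> nat \<Rightarrow> nat \<Rightarrow> nat \<Rightarrow> bool" where
  "pb_type4 a1 a2 b1 b2 \<longleftrightarrow> a1 = 0 \<and> pb_mu a1 a2 b1 b2 < 1"

definition pb_type5 :: "nat \<Rightarrow> nat \<Rightarrow> nat \<Rightarrow> nat \<Rightarrow> bool" where
  "pb_type5 a1 a2 b1 b2 \<longleftrightarrow> a1 = 0 \<and> pb_mu a1 a2 b1 b2 = 1"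

end

theory Submission
  imports Defs "HOL-Library.Real_Mod"
begin

text \<open>
  Write \<open>d1 = a1 + 2 * b1\<close> and \<open>d2 = a2 + 2 * b2\<close>. In polar coordinates the equation of the surface
  decouples: outside the origin it says that \<open>\<bar>z1\<bar> ^ d1 = \<bar>z2\<bar> ^ d2\<close> for the moduli and
  \<open>a1 * \<alpha> = a2 * \<beta> + pi\<close> modulo \<open>2 * pi\<close> for the arguments. The first condition describes a
  curve \<open>(t powr p, t powr q)\<close> of moduli with exponents at least 1, one of them equal to 1; the
  second one describes parallel closed lines on a torus, the sheets of the surface.

  For the positive results, two points are joined by going radially to the lower of their two levels
  and then turning the angles linearly, if they lie on the same line locally; otherwise by a detour
  through the origin. The first route always costs at most a multiple of the distance. The detour
  costs a multiple of the lower level, so what is needed is that different sheets are seen under a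
  fixed angle from the origin. This is the case if both exponents are 1, or if \<open>a1 = 0\<close> and the sheets
  are distinguished by the direction of a coordinate with exponent 1; and there is nothing to check
  if \<open>a1 = 0\<close> and \<open>a2 = 1\<close>, where only one sheet exists. All these cases are instances of
  \<open>lipschitz_normally_embedded_if_angles_separate\<close>.

  For the negative results, let \<open>U\<close> be the coordinate with the smaller weight, and \<open>W\<close> the other one.
  On the surface \<open>U\<close> is of smaller order than \<open>W\<close>, so that the points with \<open>W = r\<close> have mutual distances
  of order \<open>r powr \<mu>\<close> with \<open>\<mu> > 1\<close>. If the exponent \<open>a\<close> of \<open>U\<close> is at least 2, there are several such
  points, and an arc cannot pass from one to another while \<open>W\<close> stays in the right half plane:
  there the direction of \<open>U\<close> is an \<open>a\<close>-th root of a function with a continuous logarithm. So the arc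
  has length at least \<open>r\<close>. This is \<open>not_lipschitz_normally_embedded_if_several_sheets\<close>, which applies to type 4
  with the coordinates exchanged, and to type 1 because an even \<open>d1\<close> forces \<open>a1\<close> to be even.
\<close>

section \<open>Length and inner distance\<close>

lemma curve_length_le_if_lipschitz:
  fixes g :: "real \<Rightarrow> 'a::metric_space"
  assumes "L-lipschitz_on {0..1} g"
  shows "curve_length g \<le> ennreal L"
  unfolding curve_length_def
proof (safe intro!: SUP_least)
  fix n :: nat and t :: "nat \<Rightarrow> real"
  assume t: "mono t" "range t \<subseteq> {0..1}"
  have L: "L \<ge> 0" using assms lipschitz_on_nonneg by blast
  have "(\<Sum>i<n. dist (g (t i)) (g (t (Suc i)))) \<le> (\<Sum>i<n. L * (t (Suc i) - t i))"
  proof (rule sum_mono)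
    fix i
    have "t i \<le> t (Suc i)" using t(1) by (simp add: monoD)
    moreover have "dist (g (t i)) (g (t (Suc i))) \<le> L * dist (t i) (t (Suc i))"
      using t(2) by (intro lipschitz_onD[OF assms]) blast+
    ultimately show "dist (g (t i)) (g (t (Suc i))) \<le> L * (t (Suc i) - t i)"
      by (simp add: dist_real_def)
  qed
  also have "\<dots> = L * (t n - t 0)"
    by (simp add: sum_distrib_left[symmetric] sum_lessThan_telescope)
  also have "\<dots> \<le> L * 1"
  proof (rule mult_left_mono[OF _ L])
    have "t n \<in> {0..1}" "t 0 \<in> {0..1}" using t(2) by blast+
    thus "t n - t 0 \<le> 1" by simp
  qed
  finally show "ennreal (\<Sum>i<n. dist (g (t i)) (g (t (Suc i)))) \<le> ennreal L"
    by (simp add: ennreal_leI)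
qed

lemma dist_le_curve_length:
  assumes "0 \<le> s" "s \<le> 1"
  shows "ennreal (dist (g 0) (g s)) \<le> curve_length g"
proof -
  define t :: "nat \<Rightarrow> real" where "t = (\<lambda>i. if i = 0 then 0 else s)"
  have "mono t" "range t \<subseteq> {0..1}"
    using assms by (auto simp: t_def mono_def)
  hence "ennreal (\<Sum>i<1. dist (g (t i)) (g (t (Suc i)))) \<le> curve_length g"
    unfolding curve_length_def by (intro SUP_upper2[of "(1, t)"]) auto
  thus ?thesis by (simp add: t_def)
qed

text \<open>Upper bounds for the inner distance only need arcs with a Lipschitz parametrization over the
  unit interval, and Lipschitz constants are easier to follow through a concatenation than
  suprema of polygon lengths.\<close>
definition lipschitz_joined :: "'a::metric_space set \<Rightarrow> 'a \<Rightarrow> 'a \<Rightarrow> real \<Rightarrow> bool" where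
  "lipschitz_joined X x y L \<longleftrightarrow>
     (\<exists>g :: real \<Rightarrow> 'a. L-lipschitz_on {0..1} g \<and> g ` {0..1} \<subseteq> X \<and> g 0 = x \<and> g 1 = y)"

lemma inner_dist_le_if_lipschitz_joined:
  fixes X :: "'a::metric_space set"
  assumes "lipschitz_joined X x y L"
  shows "inner_dist X x y \<le> ennreal L"
proof -
  obtain g :: "real \<Rightarrow> 'a" where g: "L-lipschitz_on {0..1} g" "g ` {0..1} \<subseteq> X" "g 0 = x" "g 1 = y"
    using assms unfolding lipschitz_joined_def by blast
  have "curve_length g \<le> ennreal L"
    by (rule curve_length_le_if_lipschitz[OF g(1)])
  moreover from this have "curve_length g < \<infinity>"
    by (simp add: order_le_less_trans[OF _ ennreal_less_top])
  moreover have "path g"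
    unfolding path_def using g(1) by (rule lipschitz_on_continuous_on)
  ultimately show ?thesis
    unfolding inner_dist_def using g
    by (intro INF_lower2[of g])
      (auto simp: rectifiable_def path_image_def pathstart_def pathfinish_def)
qed

lemma lipschitz_joined_mono:
  "lipschitz_joined X x y L \<Longrightarrow> L \<le> M \<Longrightarrow> lipschitz_joined X x y M"
  unfolding lipschitz_joined_def by (elim exE conjE, rule exI, intro conjI)
    (rule lipschitz_on_mono[OF _ order_refl], assumption+)

lemma lipschitz_joined_sym:
  fixes X :: "'a::metric_space set"
  assumes "lipschitz_joined X x y L"
  shows "lipschitz_joined X y x L"
proof -
  obtain g :: "real \<Rightarrow> 'a" where g: "L-lipschitz_on {0..1} g" "g ` {0..1} \<subseteq> X" "g 0 = x" "g 1 = y"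
    using assms unfolding lipschitz_joined_def by blast
  have "L-lipschitz_on {0..1} (\<lambda>t. g (1 - t))"
  proof (rule lipschitz_onI)
    show "L \<ge> 0" by (rule lipschitz_on_nonneg[OF g(1)])
  next
    fix s t :: real assume "s \<in> {0..1}" "t \<in> {0..1}"
    hence "dist (g (1 - s)) (g (1 - t)) \<le> L * dist (1 - s) (1 - t)"
      by (intro lipschitz_onD[OF g(1)]) auto
    thus "dist (g (1 - s)) (g (1 - t)) \<le> L * dist s t"
      by (simp add: dist_real_def abs_minus_commute)
  qed
  moreover have "(\<lambda>t. g (1 - t)) ` {0..1} \<subseteq> X" using g(2) by auto
  ultimately show ?thesis
    unfolding lipschitz_joined_def using g(3,4) by (intro exI[of _ "\<lambda>t. g (1 - t)"]) simp
qed

text \<open>Running through the two arcs at double speed costs the factor 2; additivity of the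
  length would save it, but only the order of magnitude matters here.\<close>
lemma lipschitz_joined_trans:
  fixes X :: "'a::metric_space set"
  assumes "lipschitz_joined X x y L" "lipschitz_joined X y z M"
  shows "lipschitz_joined X x z (2 * (L + M))"
proof -
  obtain g :: "real \<Rightarrow> 'a" where g: "L-lipschitz_on {0..1} g" "g ` {0..1} \<subseteq> X" "g 0 = x" "g 1 = y"
    using assms(1) unfolding lipschitz_joined_def by blast
  obtain h :: "real \<Rightarrow> 'a" where h: "M-lipschitz_on {0..1} h" "h ` {0..1} \<subseteq> X" "h 0 = y" "h 1 = z"
    using assms(2) unfolding lipschitz_joined_def by blast
  have LM: "0 \<le> L" "0 \<le> M"
    using g(1) h(1) lipschitz_on_nonneg by blast+
  have 1: "(2 * (L + M))-lipschitz_on {0..1/2} (\<lambda>t. g (2 * t))"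
  proof (rule lipschitz_onI)
    fix s t :: real assume "s \<in> {0..1/2}" "t \<in> {0..1/2}"
    hence "dist (g (2 * s)) (g (2 * t)) \<le> L * dist (2 * s) (2 * t)"
      by (intro lipschitz_onD[OF g(1)]) auto
    also have "\<dots> = 2 * L * dist s t"
      by (simp add: dist_real_def abs_if)
    also have "\<dots> \<le> 2 * (L + M) * dist s t" using LM by (intro mult_right_mono) auto
    finally show "dist (g (2 * s)) (g (2 * t)) \<le> 2 * (L + M) * dist s t" .
  qed (use LM in simp)
  have 2: "(2 * (L + M))-lipschitz_on {1/2..1} (\<lambda>t. h (2 * t - 1))"
  proof (rule lipschitz_onI)
    fix s t :: real assume "s \<in> {1/2..1}" "t \<in> {1/2..1}"
    hence "dist (h (2 * s - 1)) (h (2 * t - 1)) \<le> M * dist (2 * s - 1) (2 * t - 1)"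
      by (intro lipschitz_onD[OF h(1)]) auto
    also have "\<dots> = 2 * M * dist s t"
      by (simp add: dist_real_def abs_if)
    also have "\<dots> \<le> 2 * (L + M) * dist s t" using LM by (intro mult_right_mono) auto
    finally show "dist (h (2 * s - 1)) (h (2 * t - 1)) \<le> 2 * (L + M) * dist s t" .
  qed (use LM in simp)
  define k where "k = (\<lambda>t::real. if t \<le> 1/2 then g (2 * t) else h (2 * t - 1))"
  have "(2 * (L + M))-lipschitz_on {0..1} k"
    unfolding k_def by (rule lipschitz_on_concat[OF 1 2]) (use g h in auto)
  moreover have "k t \<in> X" if t: "t \<in> {0..1}" for t
  proof (cases "t \<le> 1/2")
    case True
    hence "2 * t \<in> {0..1}" using t by auto
    hence "g (2 * t) \<in> X" using g(2) by blast
    thus ?thesis using True by (simp add: k_def)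
  next
    case False
    hence "2 * t - 1 \<in> {0..1}" using t by auto
    hence "h (2 * t - 1) \<in> X" using h(2) by blast
    thus ?thesis using False by (simp add: k_def)
  qed
  ultimately show ?thesis
    unfolding lipschitz_joined_def using g h
    by (intro exI[of _ k]) (auto simp: k_def)
qed

lemma dist_prod_le: "dist x y \<le> dist (fst x) (fst y) + dist (snd x) (snd y)"
  unfolding dist_prod_def by (simp add: sqrt_sum_squares_le_sum)

section \<open>Chords of the unit circle and monomials\<close>

lemma dist_cis: "dist (cis x) (cis y) = 2 * \<bar>sin ((x - y) / 2)\<bar>"
proof -
  have "dist (cis x) (cis y) = norm (cis y * (cis (x - y) - 1))"
    by (simp add: dist_norm right_diff_distrib cis_mult)
  also have "\<dots> = norm (exp (\<i> * of_real (x - y)) - 1)"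
    by (simp add: norm_mult cis_conv_exp)
  finally show ?thesis by (simp only: dist_exp_i_1)
qed

lemma dist_cis_le: "dist (cis x) (cis y) \<le> \<bar>x - y\<bar>"
  using abs_sin_x_le_abs_x[of "(x - y) / 2"] by (simp add: dist_cis)

text \<open>Jordan's inequality for the half angle: the sine is concave on the first quadrant.\<close>
lemma angle_le_chord:
  assumes "\<bar>u\<bar> \<le> pi"
  shows "\<bar>u\<bar> \<le> pi / 2 * dist (cis (x + u)) (cis x)"
proof -
  define y where "y = \<bar>u\<bar> / 2"
  have "convex_on {0..pi/2} (\<lambda>x. - sin x)"
  proof (rule f''_ge0_imp_convex)
    show "((\<lambda>x. - sin x) has_real_derivative - cos x) (at x)" for x :: real
      by (auto intro!: derivative_eq_intros)
    show "((\<lambda>x. - cos x) has_real_derivative sin x) (at x)" for x :: real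
      by (auto intro!: derivative_eq_intros)
    show "0 \<le> sin x" if "x \<in> {0..pi/2}" for x :: real
      using that by (intro sin_ge_zero) auto
  qed simp
  moreover have "y \<in> {0..pi/2}" using assms by (simp add: y_def)
  ultimately have "- sin y \<le> (- sin (pi/2) - - sin 0) / (pi/2 - 0) * (y - 0) + - sin 0"
    by (rule convex_onD_Icc')
  hence "y \<le> pi / 2 * sin y" by (simp add: field_simps)
  moreover have "\<bar>sin (u / 2)\<bar> \<ge> sin y"
    unfolding y_def by (cases "u \<ge> 0") auto
  ultimately have "y \<le> pi / 2 * \<bar>sin (u / 2)\<bar>"
    using mult_left_mono[OF _ pi_half_ge_zero] order_trans by blast
  thus ?thesis by (simp add: dist_cis y_def)
qed

text \<open>Since \<open>z * cnj z\<close> is a positive real, the conjugate factors change the modulus of the monomial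
  but not its argument: the modulus sees the exponent \<open>a + 2 * b\<close> and the argument sees \<open>a\<close>.\<close>
lemma mixed_monomial_polar:
  "z ^ (a + b) * cnj z ^ b = of_real (norm z ^ (a + 2 * b)) * sgn z ^ a"
proof -
  have "z ^ (a + b) * cnj z ^ b = z ^ a * (z * cnj z) ^ b"
    by (simp add: power_add power_mult_distrib mult.assoc)
  also have "z * cnj z = of_real (norm z ^ 2)"
    by (simp add: complex_norm_square[symmetric])
  also have "z ^ a = of_real (norm z ^ a) * sgn z ^ a"
    by (cases "z = 0") (auto simp: sgn_eq power_divide power_0_left)
  finally show ?thesis
    by (simp add: power_add mult_ac flip: of_real_power power_mult)
qed

lemma norm_mixed_monomial: "norm (z ^ (a + b) * cnj z ^ b) = norm z ^ (a + 2 * b)"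
  by (simp add: norm_mult norm_power mult_2 flip: power_add) (simp add: add.assoc)

section \<open>Polar parametrization of the surface\<close>

text \<open>As \<open>0 powr p = 0\<close>, the parameter \<open>t = 0\<close> gives the origin whatever the angles are, so radial
  arcs reach the origin without a case distinction.\<close>
definition polar_point :: "real \<Rightarrow> real \<Rightarrow> real \<Rightarrow> real \<Rightarrow> real \<Rightarrow> complex \<times> complex" where
  "polar_point p q t \<alpha> \<beta> = (of_real (t powr p) * cis \<alpha>, of_real (t powr q) * cis \<beta>)"

lemma dist_real_multiple: "dist (of_real x * w) (of_real y * w) = \<bar>x - y\<bar> * norm w"
  for w :: complex
  by (simp add: dist_norm norm_mult flip: left_diff_distrib of_real_diff)

lemma mixed_monomial_of_polar:
  assumes "0 \<le> t" "a + 2 * b > 0"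
  shows "(of_real (t powr r) * cis \<theta>) ^ (a + b) * cnj (of_real (t powr r) * cis \<theta>) ^ b
      = of_real (t powr (r * real (a + 2 * b))) * cis (real a * \<theta>)"
proof (cases "t = 0")
  case True
  thus ?thesis using assms by (auto simp: power_0_left)
next
  case False
  hence "t > 0" using assms by simp
  hence "sgn (of_real (t powr r) * cis \<theta>) = cis \<theta>"
    by (simp add: sgn_eq norm_mult)
  thus ?thesis
    using \<open>t > 0\<close> unfolding mixed_monomial_polar
    by (simp add: norm_mult Complex.DeMoivre powr_power mult.commute flip: of_real_power)
qed

lemma polar_point_in_surface:
  assumes "0 \<le> t" "a1 + 2 * b1 > 0" "a2 + 2 * b2 > 0"
    and pq: "p * real (a1 + 2 * b1) = q * real (a2 + 2 * b2)"
    and cis: "cis (real a1 * \<alpha>) = - cis (real a2 * \<beta>)"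
  shows "polar_point p q t \<alpha> \<beta> \<in> mixed_pb_surface a1 a2 b1 b2"
  unfolding mixed_pb_surface_def mixed_pb_def polar_point_def
  using assms by (simp add: mixed_monomial_of_polar del: complex_cnj_mult of_nat_add)

text \<open>The relation between the moduli has a one-parameter family of solutions
  \<open>(t powr p, t powr q)\<close>. Normalizing one exponent to 1 makes \<open>t\<close> the modulus of a coordinate, and with
  both exponents at least 1 the moduli are Lipschitz functions of \<open>t\<close> near the origin.\<close>
lemma surface_point_polar:
  assumes z: "z \<in> mixed_pb_surface a1 a2 b1 b2"
    and d: "a1 + 2 * b1 > 0" "a2 \<ge> 1"
    and pq: "p * real (a1 + 2 * b1) = q * real (a2 + 2 * b2)" "p = 1 \<or> q = 1" "p \<ge> 1" "q \<ge> 1"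
  obtains t \<alpha> \<beta> where "0 \<le> t" "t \<le> norm z"
    "cis (real a1 * \<alpha>) = - cis (real a2 * \<beta>)" "z = polar_point p q t \<alpha> \<beta>"
proof -
  obtain u w where uw: "z = (u, w)" by (cases z)
  have eq: "u ^ (a1 + b1) * cnj u ^ b1 = - (w ^ (a2 + b2) * cnj w ^ b2)"
    using z unfolding mixed_pb_surface_def mixed_pb_def uw by (simp add: eq_neg_iff_add_eq_0)
  have norms: "norm u ^ (a1 + 2 * b1) = norm w ^ (a2 + 2 * b2)"
    using arg_cong[OF eq, of norm] by (simp only: norm_mixed_monomial norm_minus_cancel)
  have zero: "u = 0 \<longleftrightarrow> w = 0"
  proof -
    have "norm u ^ (a1 + 2 * b1) = 0 \<longleftrightarrow> norm w ^ (a2 + 2 * b2) = 0" using norms by simp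
    thus ?thesis using d by (auto simp: power_0_left split: if_splits)
  qed
  show ?thesis
  proof (cases "u = 0")
    case True
    \<comment> \<open>At the origin the angles are free; any admissible pair serves.\<close>
    show ?thesis
    proof (rule that[of 0 0 "pi / real a2"])
      show "cis (real a1 * 0) = - cis (real a2 * (pi / real a2))" using d by simp
      show "z = polar_point p q 0 0 (pi / real a2)"
        using True zero uw by (simp add: polar_point_def)
    qed auto
  next
    case False
    hence nz: "norm u > 0" "norm w > 0" using zero by auto
    define t where "t = norm u powr (1 / p)"
    have tp: "t powr p = norm u" using pq nz by (simp add: t_def powr_powr)
    have tq: "t powr q = norm w"
    proof -
      have "t powr q = norm u powr (q / p)" by (simp add: t_def powr_powr)
      also have "q / p = real (a1 + 2 * b1) * (1 / real (a2 + 2 * b2))"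
        using pq d by (simp add: field_simps)
      also have "norm u powr \<dots> = (norm u ^ (a1 + 2 * b1)) powr (1 / real (a2 + 2 * b2))"
        using nz by (simp only: powr_powr[symmetric] powr_realpow)
      also have "\<dots> = norm w powr (real (a2 + 2 * b2) * (1 / real (a2 + 2 * b2)))"
        using nz by (simp only: norms powr_powr[symmetric] powr_realpow)
      also have "\<dots> = norm w"
        using nz d by simp
      finally show ?thesis .
    qed
    have sgn: "u = of_real (norm u) * cis (Arg u)" "w = of_real (norm w) * cis (Arg w)"
      using False zero by (simp_all add: cis_Arg sgn_eq)
    show ?thesis
    proof (rule that[of t "Arg u" "Arg w"])
      show "0 \<le> t" by (simp add: t_def)
      have "t = norm u \<or> t = norm w" using pq(2) tp tq \<open>0 \<le> t\<close> by auto
      thus "t \<le> norm z" unfolding uw using norm_fst_le norm_snd_le by (metis fst_conv snd_conv)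
      show "z = polar_point p q t (Arg u) (Arg w)"
        using sgn by (simp add: polar_point_def tp tq uw)
      have "of_real (norm u ^ (a1 + 2 * b1)) * sgn u ^ a1
          = of_real (norm u ^ (a1 + 2 * b1)) * - (sgn w ^ a2)"
        using eq unfolding mixed_monomial_polar norms by simp
      moreover have "complex_of_real (norm u ^ (a1 + 2 * b1)) \<noteq> 0" using nz by simp
      ultimately have "sgn u ^ a1 = - (sgn w ^ a2)" using mult_left_cancel by blast
      thus "cis (real a1 * Arg u) = - cis (real a2 * Arg w)"
        using False zero by (simp flip: Complex.DeMoivre add: cis_Arg)
    qed
  qed
qed

text \<open>One of the two coordinates has modulus exactly \<open>t\<close> and \<open>s\<close>, respectively, in the two points.\<close>
lemma level_gap_le_dist:
  assumes "0 \<le> s" "0 \<le> t" "p = 1 \<or> q = 1"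
  shows "\<bar>t - s\<bar> \<le> dist (polar_point p q t \<alpha> \<beta>) (polar_point p q s \<alpha>' \<beta>')"
proof -
  have gap: "\<bar>x - y\<bar> \<le> dist (of_real x * cis \<theta>) (of_real y * cis \<theta>')"
    if "0 \<le> x" "0 \<le> y" for x y \<theta> \<theta>'
    using norm_triangle_ineq3[of "of_real x * cis \<theta>" "of_real y * cis \<theta>'"] that
    by (simp add: dist_norm norm_mult)
  from assms(3) show ?thesis
  proof
    assume "p = 1"
    thus ?thesis
      using gap[of t s \<alpha> \<alpha>'] assms(1,2)
        dist_fst_le[of "polar_point p q t \<alpha> \<beta>" "polar_point p q s \<alpha>' \<beta>'"]
      by (simp add: polar_point_def)
  next
    assume "q = 1"
    thus ?thesis
      using gap[of t s \<beta> \<beta>'] assms(1,2)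
        dist_snd_le[of "polar_point p q t \<alpha> \<beta>" "polar_point p q s \<alpha>' \<beta>'"]
      by (simp add: polar_point_def)
  qed
qed

text \<open>Rotating on the smaller of two circles costs at most twice the distance of the points: the
  difference of the radii is itself bounded by that distance.\<close>
lemma chord_on_smaller_circle:
  assumes "0 \<le> y" "y \<le> x"
  shows "y * dist (cis \<theta>) (cis \<theta>') \<le> 2 * dist (of_real x * cis \<theta>) (of_real y * cis \<theta>')"
proof -
  have "y * dist (cis \<theta>) (cis \<theta>') = dist (of_real y * cis \<theta>) (of_real y * cis \<theta>')"
    using assms by (simp add: dist_norm norm_mult flip: right_diff_distrib)
  also have "\<dots> \<le> dist (of_real y * cis \<theta>) (of_real x * cis \<theta>)
      + dist (of_real x * cis \<theta>) (of_real y * cis \<theta>')"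
    by (rule dist_triangle)
  also have "dist (of_real y * cis \<theta>) (of_real x * cis \<theta>) = x - y"
    using assms by (simp add: dist_real_multiple)
  also have "x - y \<le> dist (of_real x * cis \<theta>) (of_real y * cis \<theta>')"
    using norm_triangle_ineq3[of "of_real x * cis \<theta>" "of_real y * cis \<theta>'"] assms
    by (simp add: dist_norm norm_mult)
  finally show ?thesis by simp
qed

text \<open>Each of the two arcs in a rotation at the lower level is controlled by the distance of the points,
  because angles in the range of the principal argument are comparable with chords.\<close>
lemma angles_le_dist:
  fixes p q s t \<alpha> \<beta> u v :: real
  assumes "0 \<le> s" "s \<le> t" "p \<ge> 0" "q \<ge> 0" "\<bar>u\<bar> \<le> pi" "\<bar>v\<bar> \<le> pi"
  defines "D \<equiv> dist (polar_point p q t \<alpha> \<beta>) (polar_point p q s (\<alpha> + u) (\<beta> + v))"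
  shows "s powr p * \<bar>u\<bar> \<le> pi * D" "s powr q * \<bar>v\<bar> \<le> pi * D"
proof -
  have rot: "s powr r * \<bar>w\<bar> \<le> pi * dist (of_real (t powr r) * cis \<theta>) (of_real (s powr r) * cis (\<theta> + w))"
    if "r \<ge> 0" "\<bar>w\<bar> \<le> pi" for r w \<theta>
  proof -
    have "s powr r * \<bar>w\<bar> \<le> s powr r * (pi / 2 * dist (cis \<theta>) (cis (\<theta> + w)))"
      using angle_le_chord[OF that(2), of \<theta>] by (intro mult_left_mono) (auto simp: dist_commute)
    also have "\<dots> = pi / 2 * (s powr r * dist (cis \<theta>) (cis (\<theta> + w)))" by simp
    also have "\<dots> \<le> pi / 2 * (2 * dist (of_real (t powr r) * cis \<theta>) (of_real (s powr r) * cis (\<theta> + w)))"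
      using assms that by (intro mult_left_mono chord_on_smaller_circle powr_mono2) auto
    finally show ?thesis by simp
  qed
  have "s powr p * \<bar>u\<bar> \<le> pi * dist (fst (polar_point p q t \<alpha> \<beta>))
      (fst (polar_point p q s (\<alpha> + u) (\<beta> + v)))"
    using rot[OF assms(3,5), of \<alpha>] by (simp add: polar_point_def)
  also have "\<dots> \<le> pi * D" unfolding D_def by (intro mult_left_mono dist_fst_le) simp
  finally show "s powr p * \<bar>u\<bar> \<le> pi * D" .
  have "s powr q * \<bar>v\<bar> \<le> pi * dist (snd (polar_point p q t \<alpha> \<beta>))
      (snd (polar_point p q s (\<alpha> + u) (\<beta> + v)))"
    using rot[OF assms(4,6), of \<beta>] by (simp add: polar_point_def)
  also have "\<dots> \<le> pi * D" unfolding D_def by (intro mult_left_mono dist_snd_le) simp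
  finally show "s powr q * \<bar>v\<bar> \<le> pi * D" .
qed

section \<open>Arcs in the surface\<close>

text \<open>The derivative of \<open>x powr p\<close> is at most \<open>p\<close> on the open unit interval.\<close>
lemma powr_diff_le:
  assumes "0 \<le> s" "s \<le> 1" "0 \<le> t" "t \<le> 1" "(p::real) \<ge> 1"
  shows "\<bar>t powr p - s powr p\<bar> \<le> p * \<bar>t - s\<bar>"
proof -
  have *: "y powr p - x powr p \<le> p * (y - x)" if xy: "0 \<le> x" "x < y" "y \<le> 1" for x y
  proof -
    have "\<exists>l z. z > x \<and> z < y \<and> ((\<lambda>x. x powr p) has_real_derivative l) (at z) \<and>
        y powr p - x powr p = (y - x) * l"
    proof (rule MVT[OF xy(2)])
      show "continuous_on {x..y} (\<lambda>x. x powr p)"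
        using xy assms by (intro continuous_on_powr' continuous_intros) auto
      show "(\<lambda>x. x powr p) differentiable at z" if "x < z" "z < y" for z
        using that xy by (intro differentiableI) (auto intro!: derivative_eq_intros)
    qed
    then obtain l z where z: "x < z" "z < y" "((\<lambda>x. x powr p) has_real_derivative l) (at z)"
      "y powr p - x powr p = (y - x) * l" by blast
    have "((\<lambda>x. x powr p) has_real_derivative p * z powr (p - 1)) (at z)"
      using z xy by (auto intro!: derivative_eq_intros)
    hence "l = p * z powr (p - 1)" using DERIV_unique z(3) by blast
    moreover have "z powr (p - 1) \<le> 1" using z xy assms by (intro powr_le1) auto
    ultimately have "l \<le> p" using assms by (simp add: mult_left_le)
    thus ?thesis using z(4) xy by (simp add: mult.commute mult_left_mono)
  qed
  have "s powr p \<le> t powr p" if "s \<le> t" using that assms by (intro powr_mono2) auto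
  moreover have "t powr p \<le> s powr p" if "t \<le> s" using that assms by (intro powr_mono2) auto
  ultimately show ?thesis
    using *[of s t] *[of t s] assms by (cases s t rule: linorder_cases) (auto simp: abs_if)
qed

lemma radial_arc:
  assumes "0 \<le> s" "s \<le> 1" "0 \<le> t" "t \<le> 1" "p \<ge> 1" "q \<ge> 1"
    and X: "\<And>r. 0 \<le> r \<Longrightarrow> polar_point p q r \<alpha> \<beta> \<in> X"
  shows "lipschitz_joined X (polar_point p q t \<alpha> \<beta>) (polar_point p q s \<alpha> \<beta>) ((p + q) * \<bar>t - s\<bar>)"
proof -
  define r where "r = (\<lambda>x. t + x * (s - t))"
  have r: "0 \<le> r x \<and> r x \<le> 1" if "x \<in> {0..1}" for x
  proof -
    have "r x = (1 - x) * t + x * s" by (simp add: r_def algebra_simps)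
    thus ?thesis using that assms convex_bound_le[of t 1 s "1 - x" x] by simp
  qed
  have "((p + q) * \<bar>t - s\<bar>)-lipschitz_on {0..1} (\<lambda>x. polar_point p q (r x) \<alpha> \<beta>)"
  proof (rule lipschitz_onI)
    fix x y :: real assume "x \<in> {0..1}" "y \<in> {0..1}"
    note rxy = r[OF this(1)] r[OF this(2)]
    have "dist (polar_point p q (r x) \<alpha> \<beta>) (polar_point p q (r y) \<alpha> \<beta>)
        \<le> \<bar>r x powr p - r y powr p\<bar> + \<bar>r x powr q - r y powr q\<bar>"
      using dist_prod_le[of "polar_point p q (r x) \<alpha> \<beta>" "polar_point p q (r y) \<alpha> \<beta>"]
      by (simp add: polar_point_def dist_real_multiple)
    also have "\<dots> \<le> p * \<bar>r x - r y\<bar> + q * \<bar>r x - r y\<bar>"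
      using rxy assms by (intro add_mono powr_diff_le) auto
    also have "r x - r y = (t - s) * (y - x)" by (simp add: r_def algebra_simps)
    finally show "dist (polar_point p q (r x) \<alpha> \<beta>) (polar_point p q (r y) \<alpha> \<beta>)
        \<le> (p + q) * \<bar>t - s\<bar> * dist x y"
      by (simp add: abs_mult dist_real_def distrib_right mult.assoc abs_minus_commute[of y x])
  qed (use assms in simp)
  moreover have "(\<lambda>x. polar_point p q (r x) \<alpha> \<beta>) ` {0..1} \<subseteq> X" using X r by blast
  ultimately show ?thesis
    unfolding lipschitz_joined_def
    by (intro exI[of _ "\<lambda>x. polar_point p q (r x) \<alpha> \<beta>"]) (simp add: r_def)
qed

lemma rotation_arc:
  assumes X: "\<And>x. polar_point p q s (\<alpha> + x * u) (\<beta> + x * v) \<in> X"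
  shows "lipschitz_joined X (polar_point p q s \<alpha> \<beta>) (polar_point p q s (\<alpha> + u) (\<beta> + v))
    (s powr p * \<bar>u\<bar> + s powr q * \<bar>v\<bar>)"
proof -
  have "(s powr p * \<bar>u\<bar> + s powr q * \<bar>v\<bar>)-lipschitz_on {0..1}
      (\<lambda>x. polar_point p q s (\<alpha> + x * u) (\<beta> + x * v))"
  proof (rule lipschitz_onI)
    fix x y :: real
    have arc: "dist (of_real (s powr r) * cis (\<theta> + x * w)) (of_real (s powr r) * cis (\<theta> + y * w))
        \<le> s powr r * \<bar>w\<bar> * dist x y" for r \<theta> w
    proof -
      have "dist (of_real (s powr r) * cis (\<theta> + x * w)) (of_real (s powr r) * cis (\<theta> + y * w))
          = s powr r * dist (cis (\<theta> + x * w)) (cis (\<theta> + y * w))"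
        by (simp add: dist_norm norm_mult flip: right_diff_distrib)
      also have "\<dots> \<le> s powr r * \<bar>(\<theta> + x * w) - (\<theta> + y * w)\<bar>"
        by (intro mult_left_mono dist_cis_le) simp
      also have "(\<theta> + x * w) - (\<theta> + y * w) = w * (x - y)" by (simp add: algebra_simps)
      finally show ?thesis by (simp add: abs_mult dist_real_def)
    qed
    show "dist (polar_point p q s (\<alpha> + x * u) (\<beta> + x * v)) (polar_point p q s (\<alpha> + y * u) (\<beta> + y * v))
        \<le> (s powr p * \<bar>u\<bar> + s powr q * \<bar>v\<bar>) * dist x y"
      using dist_prod_le[of "polar_point p q s (\<alpha> + x * u) (\<beta> + x * v)"
          "polar_point p q s (\<alpha> + y * u) (\<beta> + y * v)"] arc[of p \<alpha> u] arc[of q \<beta> v]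
      by (simp add: polar_point_def distrib_right)
  qed simp
  moreover have "(\<lambda>x. polar_point p q s (\<alpha> + x * u) (\<beta> + x * v)) ` {0..1} \<subseteq> X"
    using X by blast
  ultimately show ?thesis
    unfolding lipschitz_joined_def
    by (intro exI[of _ "\<lambda>x. polar_point p q s (\<alpha> + x * u) (\<beta> + x * v)"]) simp
qed

section \<open>Sheets seen under a fixed angle\<close>

lemma lipschitz_normally_embedded_if_bounded:
  fixes X :: "'a::real_normed_vector set"
  assumes "C > 0"
    and "\<And>x y. x \<in> X \<Longrightarrow> y \<in> X \<Longrightarrow> norm x \<le> 1 \<Longrightarrow> norm y \<le> 1 \<Longrightarrow>
      lipschitz_joined X x y (C * dist x y)"
  shows "lipschitz_normally_embedded_at X 0"
  unfolding lipschitz_normally_embedded_at_def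
  using assms
  by (intro exI[of _ "ball 0 1"] exI[of _ C]) (auto intro!: inner_dist_le_if_lipschitz_joined)

text \<open>Let \<open>u\<close> and \<open>v\<close> be the principal differences of the angles of two points. On the surface
  \<open>a1 * u - a2 * v\<close> is a multiple of \<open>2 * pi\<close>. If it is 0, moving radially to the lower level and then
  turning both angles linearly stays in the surface, at a cost proportional to the distance. If it is
  not 0, then \<open>a1 * \<bar>u\<bar> + a2 * \<bar>v\<bar>\<close> is at least \<open>2 * pi\<close>, and the detour through the origin, of cost
  comparable with the lower level \<open>s\<close>, is affordable once \<open>s * \<bar>u\<bar>\<close> and \<open>s * \<bar>v\<bar>\<close> are bounded by the
  distance. This holds for an angle whose coordinate has exponent 1. The last two hypotheses say
  that an angle with a larger exponent is harmless: \<open>u\<close> does not enter if \<open>a1 = 0\<close>, and with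
  moreover \<open>a2 = 1\<close> the second case cannot occur, since \<open>v\<close> is at most \<open>pi\<close> in modulus.\<close>
lemma lipschitz_normally_embedded_if_angles_separate:
  assumes d: "a1 + 2 * b1 > 0" "a2 \<ge> 1"
    and pq: "p * real (a1 + 2 * b1) = q * real (a2 + 2 * b2)" "p = 1 \<or> q = 1" "p \<ge> 1" "q \<ge> 1"
    and p: "a1 = 0 \<or> p = 1" and q: "q = 1 \<or> a1 = 0 \<and> a2 = 1"
  shows "lipschitz_normally_embedded_at (mixed_pb_surface a1 a2 b1 b2) 0"
proof -
  define X where "X = mixed_pb_surface a1 a2 b1 b2"
  define P where "P = polar_point p q"
  define C where "C = 8 * (p + q) + 4 * pi + 8 * (p + q) * real (a1 + a2)"
  have C: "C > 0" using pq(3,4) pi_gt_zero unfolding C_def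
    by (intro add_pos_nonneg) auto
  have joined: "lipschitz_joined X x y (C * dist x y)"
    if cisx: "cis (real a1 * \<alpha>) = - cis (real a2 * \<beta>)"
      and cisy: "cis (real a1 * \<alpha>') = - cis (real a2 * \<beta>')"
      and st: "0 \<le> s" "s \<le> t" "t \<le> 1" and x: "x = P t \<alpha> \<beta>" and y: "y = P s \<alpha>' \<beta>'"
    for x y s t \<alpha> \<beta> \<alpha>' \<beta>'
  proof -
    \<comment> \<open>Only the residues of the angles matter: measure them in the shortest way.\<close>
    define u where "u = Arg (cis (\<alpha>' - \<alpha>))"
    define v where "v = Arg (cis (\<beta>' - \<beta>))"
    have u: "\<bar>u\<bar> \<le> pi" "cis u = cis (\<alpha>' - \<alpha>)"
      unfolding u_def using Arg_bounded[of "cis (\<alpha>' - \<alpha>)"] by (auto simp: cis_Arg)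
    have v: "\<bar>v\<bar> \<le> pi" "cis v = cis (\<beta>' - \<beta>)"
      unfolding v_def using Arg_bounded[of "cis (\<beta>' - \<beta>)"] by (auto simp: cis_Arg)
    have "cis (\<alpha> + u) = cis \<alpha>'"
      by (simp only: cis_mult[of \<alpha> u, symmetric] u(2)) (simp add: cis_mult)
    moreover have "cis (\<beta> + v) = cis \<beta>'"
      by (simp only: cis_mult[of \<beta> v, symmetric] v(2)) (simp add: cis_mult)
    ultimately have y': "y = P s (\<alpha> + u) (\<beta> + v)" and
      cisy': "cis (real a1 * (\<alpha> + u)) = - cis (real a2 * (\<beta> + v))"
      using y cisy by (simp_all add: P_def polar_point_def flip: Complex.DeMoivre)
    define D where "D = dist x y"
    have D: "D \<ge> 0" by (simp add: D_def)
    have gap: "t - s \<le> D"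
      using level_gap_le_dist[of s t p q \<alpha> \<beta> \<alpha>' \<beta>'] st pq(2) by (simp add: D_def x y P_def)
    have ang: "s powr p * \<bar>u\<bar> \<le> pi * D" "s powr q * \<bar>v\<bar> \<le> pi * D"
      using angles_le_dist[of s t p q u v \<alpha> \<beta>] st pq u(1) v(1) by (auto simp: D_def x y' P_def)
    have XP: "P r \<theta> \<eta> \<in> X" if "0 \<le> r" "cis (real a1 * \<theta>) = - cis (real a2 * \<eta>)" for r \<theta> \<eta>
      unfolding X_def P_def using that d pq(1) by (intro polar_point_in_surface) auto
    have radial: "lipschitz_joined X (P r \<theta> \<eta>) (P r' \<theta> \<eta>) ((p + q) * \<bar>r - r'\<bar>)"
      if "cis (real a1 * \<theta>) = - cis (real a2 * \<eta>)" "0 \<le> r" "r \<le> 1" "0 \<le> r'" "r' \<le> 1" for r r' \<theta> \<eta>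
      unfolding P_def using that pq(3,4) XP unfolding P_def by (intro radial_arc) auto
    have down: "lipschitz_joined X x (P s \<alpha> \<beta>) ((p + q) * D)"
    proof (rule lipschitz_joined_mono)
      show "lipschitz_joined X x (P s \<alpha> \<beta>) ((p + q) * \<bar>t - s\<bar>)"
        using radial[OF cisx, of t s] st x by simp
      show "(p + q) * \<bar>t - s\<bar> \<le> (p + q) * D"
        using gap st pq(3,4) by (intro mult_left_mono) auto
    qed
    have "cis (real a1 * u) = cis (real a2 * v)"
    proof -
      have "cis (real a1 * u) = cis (real a1 * (\<alpha> + u)) / cis (real a1 * \<alpha>)"
        by (simp add: cis_divide algebra_simps)
      also have "\<dots> = cis (real a2 * (\<beta> + v)) / cis (real a2 * \<beta>)"
        by (simp add: cisx cisy')
      also have "\<dots> = cis (real a2 * v)"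
        by (simp add: cis_divide algebra_simps)
      finally show ?thesis .
    qed
    hence "cis (real a1 * u - real a2 * v) = 1"
      by (simp flip: cis_divide)
    then obtain n :: int where n: "real a1 * u - real a2 * v = of_int n * (2 * pi)"
      using cis_eq_1_iff by blast
    show ?thesis
    proof (cases "n = 0")
      case True
      \<comment> \<open>Both points lie on the same sheet and the segment of angles stays on it.\<close>
      have "lipschitz_joined X (P s \<alpha> \<beta>) y (s powr p * \<bar>u\<bar> + s powr q * \<bar>v\<bar>)"
        unfolding y' P_def
      proof (rule rotation_arc)
        fix r :: real
        have "real a1 * u = real a2 * v" using n True by simp
        hence ruv: "real a1 * (r * u) = real a2 * (r * v)" by (metis mult.left_commute)
        have "cis (real a1 * (\<alpha> + r * u)) = - cis (real a2 * (\<beta> + r * v))"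
          by (simp only: distrib_left cisx ruv mult_minus_left flip: cis_mult)
        thus "polar_point p q s (\<alpha> + r * u) (\<beta> + r * v) \<in> X"
          using XP st by (simp add: P_def)
      qed
      from lipschitz_joined_trans[OF down this]
      show ?thesis
      proof (rule lipschitz_joined_mono)
        have "2 * ((p + q) * D + (s powr p * \<bar>u\<bar> + s powr q * \<bar>v\<bar>))
            \<le> 2 * ((p + q) * D + (pi * D + pi * D))"
          using ang by (intro mult_left_mono add_left_mono add_mono) auto
        also have "\<dots> = (2 * (p + q) + 4 * pi) * D" by (simp add: algebra_simps)
        also have "\<dots> \<le> C * D"
          using pq(3,4) D unfolding C_def by (intro mult_right_mono) auto
        finally show "2 * ((p + q) * D + (s powr p * \<bar>u\<bar> + s powr q * \<bar>v\<bar>)) \<le> C * dist x y"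
          by (simp add: D_def)
      qed
    next
      case False
      \<comment> \<open>Different sheets are apart by a fixed angle, so the detour through the origin is
        cheap.\<close>
      have "1 \<le> \<bar>real_of_int n\<bar>" using False by linarith
      hence "2 * pi \<le> \<bar>real a1 * u - real a2 * v\<bar>"
        unfolding n by (simp add: abs_mult)
      also have "\<dots> \<le> real a1 * \<bar>u\<bar> + real a2 * \<bar>v\<bar>"
        using abs_triangle_ineq4[of "real a1 * u" "real a2 * v"] by (simp add: abs_mult)
      finally have big: "2 * pi \<le> real a1 * \<bar>u\<bar> + real a2 * \<bar>v\<bar>" .
      have q1: "q = 1"
      proof (rule ccontr)
        assume "q \<noteq> 1"
        hence "2 * pi \<le> \<bar>v\<bar>" using q big by auto
        thus False using v(1) pi_gt_zero by linarith
      qed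
      have "s * (2 * pi) \<le> s * (real a1 * \<bar>u\<bar> + real a2 * \<bar>v\<bar>)"
        using big st by (intro mult_left_mono) auto
      also have "\<dots> = real a1 * (s * \<bar>u\<bar>) + real a2 * (s * \<bar>v\<bar>)" by (simp add: algebra_simps)
      also have "\<dots> \<le> real a1 * (pi * D) + real a2 * (pi * D)"
        using p q1 ang st by (intro add_mono) (auto intro: mult_left_mono)
      also have "\<dots> = pi * (real (a1 + a2) * D)"
        by (simp add: algebra_simps)
      finally have "pi * (2 * s) \<le> pi * (real (a1 + a2) * D)" by (simp only: mult_ac)
      hence sD: "2 * s \<le> real (a1 + a2) * D" using mult_le_cancel_left_pos pi_gt_zero by blast
      have "lipschitz_joined X (P s \<alpha> \<beta>) (P 0 \<alpha> \<beta>) ((p + q) * s)"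
        using radial[OF cisx, of s 0] st by simp
      moreover have "P 0 \<alpha> \<beta> = P 0 \<alpha>' \<beta>'" by (simp add: P_def polar_point_def)
      moreover have "lipschitz_joined X (P 0 \<alpha>' \<beta>') y ((p + q) * s)"
        using radial[OF cisy, of 0 s] st y by simp
      ultimately have "lipschitz_joined X (P s \<alpha> \<beta>) y (2 * ((p + q) * s + (p + q) * s))"
        using lipschitz_joined_trans by metis
      from lipschitz_joined_trans[OF down this]
      show ?thesis
      proof (rule lipschitz_joined_mono)
        have "2 * ((p + q) * D + 2 * ((p + q) * s + (p + q) * s))
            = 2 * (p + q) * D + 4 * (p + q) * (2 * s)" by (simp add: algebra_simps)
        also have "\<dots> \<le> 2 * (p + q) * D + 4 * (p + q) * (real (a1 + a2) * D)"
          using sD pq(3,4) by (intro add_left_mono mult_left_mono) auto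
        also have "\<dots>
            = (2 * (p + q) + 4 * (p + q) * real (a1 + a2)) * D" by (simp add: algebra_simps)
        also have "\<dots> \<le> C * D"
          using pq(3,4) D unfolding C_def by (intro mult_right_mono add_mono) auto
        finally show "2 * ((p + q) * D + 2 * ((p + q) * s + (p + q) * s)) \<le> C * dist x y"
          by (simp add: D_def)
      qed
    qed
  qed
  show ?thesis
  proof (rule lipschitz_normally_embedded_if_bounded[OF C])
    fix x y assume x: "x \<in> mixed_pb_surface a1 a2 b1 b2" "norm x \<le> 1"
      and y: "y \<in> mixed_pb_surface a1 a2 b1 b2" "norm y \<le> 1"
    obtain t \<alpha> \<beta> where t: "0 \<le> t" "t \<le> norm x"
      "cis (real a1 * \<alpha>) = - cis (real a2 * \<beta>)" "x = P t \<alpha> \<beta>"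
      using surface_point_polar[OF x(1) d pq] unfolding P_def by metis
    obtain s \<alpha>' \<beta>' where s: "0 \<le> s" "s \<le> norm y"
      "cis (real a1 * \<alpha>') = - cis (real a2 * \<beta>')" "y = P s \<alpha>' \<beta>'"
      using surface_point_polar[OF y(1) d pq] unfolding P_def by metis
    show "lipschitz_joined (mixed_pb_surface a1 a2 b1 b2) x y (C * dist x y)"
    proof (cases "s \<le> t")
      case True
      thus ?thesis using joined[OF t(3) s(3) s(1) True _ t(4) s(4)] t(2) x(2) by (simp add: X_def)
    next
      case False
      hence "lipschitz_joined X y x (C * dist y x)"
        using joined[OF s(3) t(3) t(1) _ _ s(4) t(4)] s(2) y(2) by simp
      thus ?thesis using lipschitz_joined_sym unfolding X_def by (metis dist_commute)
    qed
  qed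
qed

section \<open>Paths that cannot change sheets\<close>

text \<open>Over the right half plane the argument of \<open>w\<close> is continuous, so dividing the direction of \<open>u\<close> by
  a continuous \<open>a\<close>-th root of the \<open>a'\<close>-th power of the direction of \<open>w\<close> leaves a continuous function whose \<open>a\<close>-th
  power is \<open>-1\<close>. It takes finitely many values, hence is constant: the sheet cannot change.\<close>
lemma path_over_half_plane_closes:
  fixes u w :: "real \<Rightarrow> complex"
  assumes cont: "continuous_on {0..1} u" "continuous_on {0..1} w"
    and d: "a \<ge> 1"
    and eq: "\<And>t. t \<in> {0..1} \<Longrightarrow>
      u t ^ (a + b) * cnj (u t) ^ b + w t ^ (a' + b') * cnj (w t) ^ b' = 0"
    and w: "\<And>t. t \<in> {0..1} \<Longrightarrow> Re (w t) > 0"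
    and ends: "w 0 = w 1"
  shows "u 0 = u 1"
proof -
  have w0: "w t \<noteq> 0" if "t \<in> {0..1}" for t using w[OF that] by auto
  have eq': "of_real (norm (u t) ^ (a + 2 * b)) * sgn (u t) ^ a
      = - (of_real (norm (w t) ^ (a' + 2 * b')) * sgn (w t) ^ a')" if "t \<in> {0..1}" for t
    using eq[OF that] unfolding mixed_monomial_polar by (simp add: eq_neg_iff_add_eq_0)
  have norms: "norm (u t) ^ (a + 2 * b) = norm (w t) ^ (a' + 2 * b')" if "t \<in> {0..1}" for t
  proof -
    have "u t ^ (a + b) * cnj (u t) ^ b = - (w t ^ (a' + b') * cnj (w t) ^ b')"
      using eq[OF that] by (simp add: eq_neg_iff_add_eq_0)
    from arg_cong[OF this, of norm] show ?thesis
      by (simp only: norm_mixed_monomial norm_minus_cancel)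
  qed
  have u0: "u t \<noteq> 0" if "t \<in> {0..1}" for t
    using norms[OF that] w0[OF that] d by (auto simp: power_0_left)
  define h where "h = (\<lambda>t. sgn (u t) * cis (- real a' * Arg (w t) / real a))"
  have "continuous_on {0..1} h"
    unfolding h_def sgn_eq cis_conv_exp using cont u0 w d
    by (intro continuous_intros) (force simp: complex_nonpos_Reals_iff)+
  moreover have "h ` {0..1} \<subseteq> {z. z ^ a = - 1}"
  proof safe
    fix t :: real assume t: "t \<in> {0..1}"
    have "sgn (u t) ^ a = - (sgn (w t) ^ a')"
    proof -
      have "of_real (norm (w t) ^ (a' + 2 * b')) * sgn (u t) ^ a
          = of_real (norm (w t) ^ (a' + 2 * b')) * - (sgn (w t) ^ a')"
        using eq'[OF t] unfolding norms[OF t] by simp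
      moreover have "complex_of_real (norm (w t) ^ (a' + 2 * b')) \<noteq> 0" using w0[OF t] by simp
      ultimately show ?thesis using mult_left_cancel by blast
    qed
    also have "sgn (w t) ^ a' = cis (real a' * Arg (w t))"
      using w0[OF t] by (simp add: cis_Arg flip: Complex.DeMoivre)
    finally show "h t ^ a = - 1"
      using d by (simp add: h_def power_mult_distrib Complex.DeMoivre cis_mult)
  qed
  moreover have "finite {z::complex. z ^ a = - 1}" using d by (intro finite_nth_roots) simp
  ultimately have "h constant_on {0..1}"
    by (intro continuous_finite_range_constant) (auto intro: finite_subset)
  hence "h 0 = h 1" by (auto simp: constant_on_def)
  hence "sgn (u 0) = sgn (u 1)" by (simp add: h_def ends)
  moreover have "norm (u 0) = norm (u 1)"
  proof -
    have "norm (u 0) ^ (a + 2 * b) = norm (u 1) ^ (a + 2 * b)" by (simp add: norms ends)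
    thus ?thesis by (rule power_eq_imp_eq_base) (use d in auto)
  qed
  ultimately show ?thesis using u0[of 0] by (auto simp: sgn_eq)
qed

text \<open>The two points approach each other faster than linearly in \<open>r\<close>, while each arc joining them has
  length at least \<open>r\<close>.\<close>
lemma not_lipschitz_normally_embedded_if_detour:
  fixes X :: "'a::real_normed_vector set" and x y :: "real \<Rightarrow> 'a"
  assumes \<mu>: "\<mu> > 1"
    and X: "\<And>r. 0 < r \<Longrightarrow> x r \<in> X" "\<And>r. 0 < r \<Longrightarrow> y r \<in> X"
    and lim: "(x \<longlongrightarrow> p) (at_right 0)" "(y \<longlongrightarrow> p) (at_right 0)"
    and close: "\<And>r. 0 < r \<Longrightarrow> dist (x r) (y r) \<le> K * r powr \<mu>"
    and detour: "\<And>r g. 0 < r \<Longrightarrow> path g \<Longrightarrow> path_image g \<subseteq> X \<Longrightarrow> pathstart g = x r \<Longrightarrow>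
      pathfinish g = y r \<Longrightarrow> \<exists>t\<in>{0..1}. dist (x r) (g t) \<ge> r"
  shows "\<not> lipschitz_normally_embedded_at X p"
proof
  assume "lipschitz_normally_embedded_at X p"
  then obtain U C where U: "open U" "p \<in> U" and "C > 0" and
    inner: "\<And>x y. x \<in> X \<inter> U \<Longrightarrow> y \<in> X \<inter> U \<Longrightarrow> inner_dist X x y \<le> ennreal (C * dist x y)"
    unfolding lipschitz_normally_embedded_at_def by blast
  have "((\<lambda>r. C * K * r powr (\<mu> - 1)) \<longlongrightarrow> C * K * 0 powr (\<mu> - 1)) (at_right 0)"
    by (intro tendsto_intros tendsto_powr') (use \<mu> in \<open>auto intro: eventually_at_rightI[of 0 1]\<close>)
  hence "\<forall>\<^sub>F r in at_right 0. C * K * r powr (\<mu> - 1) < 1"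
    by (rule order_tendstoD) simp
  hence "\<forall>\<^sub>F r in at_right 0. C * K * r powr (\<mu> - 1) < 1 \<and> x r \<in> U \<and> y r \<in> U \<and> 0 < r"
    using topological_tendstoD[OF lim(1) U] topological_tendstoD[OF lim(2) U]
      eventually_at_right_less[of "0::real"]
    by eventually_elim simp
  then obtain r where r: "C * K * r powr (\<mu> - 1) < 1" "x r \<in> U" "y r \<in> U" "0 < r"
    using eventually_happens'[OF trivial_limit_at_right_real] by blast
  have "ennreal r \<le> inner_dist X (x r) (y r)"
    unfolding inner_dist_def
  proof (rule INF_greatest)
    fix g assume "g \<in> {g. rectifiable g \<and> path_image g \<subseteq> X \<and> pathstart g = x r \<and> pathfinish g = y r}"
    then obtain t where t: "t \<in> {0..1}" "r \<le> dist (x r) (g t)" and "g 0 = x r"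
      using detour[OF r(4), of g] by (auto simp: rectifiable_def pathstart_def)
    thus "ennreal r \<le> curve_length g"
      using dist_le_curve_length[of t g] by (auto intro: order_trans ennreal_leI)
  qed
  also have "\<dots> \<le> ennreal (C * dist (x r) (y r))"
    using r X by (intro inner) auto
  finally have "r \<le> C * dist (x r) (y r)"
    using \<open>C > 0\<close> by (simp add: ennreal_le_iff)
  also have "\<dots> \<le> C * (K * r powr \<mu>)" using close[OF r(4)] \<open>C > 0\<close> by simp
  also have "r powr \<mu> = r powr (\<mu> - 1) * r"
    using r(4) by (simp add: powr_diff)
  also have "C * (K * \<dots>) = C * K * r powr (\<mu> - 1) * r" by simp
  also have "\<dots> < r" using r by simp
  finally show False by simp
qed

text \<open>Over a positive real \<open>r\<close> in the coordinate \<open>W\<close> lie \<open>a\<close> points of the surface, all with \<open>U\<close> of the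
  much smaller modulus \<open>r powr \<mu>\<close>. An arc between two of them must leave the disc of radius \<open>r\<close>
  around \<open>r\<close> in the coordinate \<open>W\<close>, since that disc lies in the right half plane. Abstract coordinate
  functions let either variable play the role of \<open>U\<close>.\<close>
lemma not_lipschitz_normally_embedded_if_several_sheets:
  fixes U W :: "complex \<times> complex \<Rightarrow> complex"
  assumes coords: "U = fst \<and> W = snd \<or> U = snd \<and> W = fst"
    and a: "a \<ge> 2" and d: "a + 2 * b < a' + 2 * b'"
  shows "\<not> lipschitz_normally_embedded_at
    {z. U z ^ (a + b) * cnj (U z) ^ b + W z ^ (a' + b') * cnj (W z) ^ b' = 0} 0"
    (is "\<not> lipschitz_normally_embedded_at ?X 0")
proof -
  define pt where "pt = (\<lambda>u w. if U = fst then (u, w) else (w, u :: complex))"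
  have ne: "(fst :: complex \<times> complex \<Rightarrow> complex) \<noteq> snd"
    by (metis fst_conv snd_conv zero_neq_one)
  have pt: "U (pt u w) = u" "W (pt u w) = w" for u w
    using coords ne by (auto simp: pt_def)
  have dist_pt: "dist (pt u w) (pt u' w) = dist u u'" for u u' w
    by (simp add: pt_def dist_Pair_Pair)
  have W_dist: "dist (W z) (W z') \<le> dist z z'" for z z'
    using coords dist_fst_le dist_snd_le by metis
  define \<mu> where "\<mu> = real (a' + 2 * b') / real (a + 2 * b)"
  have \<mu>: "\<mu> > 1" using a d by (simp add: \<mu>_def)
  \<comment> \<open>For odd \<open>c\<close> the \<open>a\<close>-th power of the direction of \<open>U\<close> is \<open>-1\<close>; the values 1 and 3 give different
    sheets as soon as there are two.\<close>
  define x where "x = (\<lambda>c r. pt (of_real (r powr \<mu>) * cis (c * pi / real a)) (of_real r))"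
  have x_in: "x c r \<in> ?X" if "0 < r" "cis (c * pi) = - 1" for c r
  proof -
    have "U (x c r) ^ (a + b) * cnj (U (x c r)) ^ b
        = of_real (r powr (\<mu> * real (a + 2 * b))) * cis (real a * (c * pi / real a))"
      unfolding x_def pt using a that by (intro mixed_monomial_of_polar) auto
    also have "\<mu> * real (a + 2 * b) = real (a' + 2 * b')" using a by (simp add: \<mu>_def)
    also have "real a * (c * pi / real a) = c * pi" using a by simp
    finally have U: "U (x c r) ^ (a + b) * cnj (U (x c r)) ^ b = - of_real (r powr real (a' + 2 * b'))"
      using that by simp
    have "W (x c r) ^ (a' + b') * cnj (W (x c r)) ^ b'
        = (of_real (r powr 1) * cis 0) ^ (a' + b') * cnj (of_real (r powr 1) * cis 0) ^ b'"
      using that by (simp add: x_def pt)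
    also have "\<dots> = of_real (r powr (1 * real (a' + 2 * b'))) * cis (real a' * 0)"
      using d that by (intro mixed_monomial_of_polar) auto
    finally show ?thesis using U by simp
  qed
  have lim: "(x c \<longlongrightarrow> 0) (at_right 0)" for c
  proof -
    have "((\<lambda>r. complex_of_real (r powr \<mu>) * cis (c * pi / real a)) \<longlongrightarrow>
        complex_of_real (0 powr \<mu>) * cis (c * pi / real a)) (at_right 0)"
      by (intro tendsto_intros tendsto_powr') (use \<mu> in \<open>auto intro: eventually_at_rightI[of 0 1]\<close>)
    moreover have "((\<lambda>r. complex_of_real r) \<longlongrightarrow> complex_of_real 0) (at_right 0)"
      by (intro tendsto_intros)
    ultimately show ?thesis
      unfolding x_def pt_def zero_prod_def
      by (cases "U = fst") (auto dest: tendsto_Pair)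
  qed
  have roots: "cis (1 * pi / real a) \<noteq> cis (3 * pi / real a)"
  proof
    assume eq: "cis (1 * pi / real a) = cis (3 * pi / real a)"
    have "cis (3 * pi / real a - 1 * pi / real a) = cis (3 * pi / real a) / cis (1 * pi / real a)"
      by (rule cis_divide[symmetric])
    also have "\<dots> = 1" using eq by simp
    finally have "cis (3 * pi / real a - 1 * pi / real a) = 1" .
    moreover have "3 * pi / real a - 1 * pi / real a = 2 * pi / real a"
      by (simp add: diff_divide_distrib[symmetric])
    ultimately have "cos (2 * pi / real a) = cos 0"
      by (metis cis.sel(1) cos_zero one_complex.sel(1))
    moreover have "cos (2 * pi / real a) < cos 0"
      using a by (intro cos_monotone_0_pi) (auto simp: field_simps)
    ultimately show False by simp
  qed
  show ?thesis
  proof (rule not_lipschitz_normally_embedded_if_detour[OF \<mu> _ _ lim[of 1] lim[of 3]])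
    show "x 1 r \<in> ?X" if "0 < r" for r using that by (intro x_in) auto
    have "cis (3 * pi) = - 1" using cis_mult[of pi "2 * pi"] by simp
    thus "x 3 r \<in> ?X" if "0 < r" for r using that by (intro x_in) auto
    show "dist (x 1 r) (x 3 r) \<le> 2 * r powr \<mu>" if "0 < r" for r
      using norm_triangle_ineq4[of "of_real (r powr \<mu>) * cis (1 * pi / real a)"
          "of_real (r powr \<mu>) * cis (3 * pi / real a)"]
      unfolding x_def dist_pt by (simp add: dist_norm norm_mult)
  next
    fix r :: real and g assume r: "0 < r" and g: "path g" "path_image g \<subseteq> ?X"
      "pathstart g = x 1 r" "pathfinish g = x 3 r"
    show "\<exists>t\<in>{0..1}. r \<le> dist (x 1 r) (g t)"
    proof (rule ccontr)
      assume "\<not> ?thesis"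
      hence near: "dist (x 1 r) (g t) < r" if "t \<in> {0..1}" for t using that by force
      have Re: "Re (W (g t)) > 0" if "t \<in> {0..1}" for t
      proof -
        have "dist (W (x 1 r)) (W (g t)) < r"
          using near[OF that] W_dist order_le_less_trans by blast
        hence "norm (of_real r - W (g t)) < r" by (simp add: x_def pt dist_norm)
        thus ?thesis using abs_Re_le_cmod[of "of_real r - W (g t)"] by simp
      qed
      have cont: "continuous_on {0..1} (\<lambda>t. U (g t))" "continuous_on {0..1} (\<lambda>t. W (g t))"
        using g(1) coords unfolding path_def by (auto intro!: continuous_intros)
      have ends: "g 0 = x 1 r" "g 1 = x 3 r" using g by (auto simp: pathstart_def pathfinish_def)
      have "U (g 0) = U (g 1)"
      proof (rule path_over_half_plane_closes[OF cont])
        show "U (g t) ^ (a + b) * cnj (U (g t)) ^ b + W (g t) ^ (a' + b') * cnj (W (g t)) ^ b' = 0"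
          if "t \<in> {0..1}" for t
          using g(2) that unfolding path_image_def by blast
      qed (use a Re ends in \<open>simp_all add: x_def pt\<close>)
      thus False using roots r by (simp add: ends x_def pt)
    qed
  qed
qed

section \<open>Lipschitz normal embedding of mixed Pham-Brieskorn surfaces\<close>

theorem proposition6p3:
  fixes a1 a2 b1 b2 :: nat
  assumes "a1 \<le> a2" and "a2 \<ge> 1"
    and "a1 = 0 \<Longrightarrow> b1 \<ge> 1"
    and "(a1, b1) \<noteq> (1, 0)" and "(a2, b2) \<noteq> (1, 0)"
    and "pb_type1 a1 a2 b1 b2 \<Longrightarrow> gcd a1 a2 = 1"
  shows
    "(pb_type2 a1 a2 b1 b2 \<or> pb_type5 a1 a2 b1 b2 \<longrightarrow>
        lipschitz_normally_embedded_at (mixed_pb_surface a1 a2 b1 b2) 0) \<and>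
     (pb_type3 a1 a2 b1 b2 \<longrightarrow>
        lipschitz_normally_embedded_at (mixed_pb_surface a1 a2 b1 b2) 0) \<and>
     (pb_type4 a1 a2 b1 b2 \<and> a2 = 1 \<longrightarrow>
        lipschitz_normally_embedded_at (mixed_pb_surface a1 a2 b1 b2) 0) \<and>
     (pb_type4 a1 a2 b1 b2 \<and> a2 \<ge> 2 \<longrightarrow>
        \<not> lipschitz_normally_embedded_at (mixed_pb_surface a1 a2 b1 b2) 0) \<and>
     (pb_type1 a1 a2 b1 b2 \<and> even (a1 + 2 * b1) \<longrightarrow>
        \<not> lipschitz_normally_embedded_at (mixed_pb_surface a1 a2 b1 b2) 0)"
proof -
  define d1 where "d1 = a1 + 2 * b1"
  define d2 where "d2 = a2 + 2 * b2"
  have d: "d1 > 0" "d2 > 0" using assms(2,3) by (auto simp: d1_def d2_def)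
  have \<mu>: "pb_mu a1 a2 b1 b2 = real d2 / real d1" by (simp add: pb_mu_def d1_def d2_def)
  \<comment> \<open>Equal weights give a cone; this covers the types 2 and 5.\<close>
  have cone: "lipschitz_normally_embedded_at (mixed_pb_surface a1 a2 b1 b2) 0" if "d1 = d2"
    using that d assms(2)
    by (intro lipschitz_normally_embedded_if_angles_separate[where p = 1 and q = 1])
      (auto simp: d1_def d2_def)
  \<comment> \<open>For type 3 the second coordinate runs on finitely many rays, each carrying a horn.\<close>
  have horns: "lipschitz_normally_embedded_at (mixed_pb_surface a1 a2 b1 b2) 0"
    if "a1 = 0" "d1 < d2"
    using that d assms(2)
    by (intro lipschitz_normally_embedded_if_angles_separate[where p = "d2 / d1" and q = 1])
      (auto simp: d1_def d2_def)
  \<comment> \<open>For type 4 the surface is a union of \<open>a2\<close> graphs over the plane of the first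
    coordinate, tangent to that plane at the origin; they meet only there.\<close>
  have graph: "lipschitz_normally_embedded_at (mixed_pb_surface a1 a2 b1 b2) 0"
    if "a1 = 0" "a2 = 1" "d2 < d1"
    using that d assms(2)
    by (intro lipschitz_normally_embedded_if_angles_separate[where p = 1 and q = "d1 / d2"])
      (auto simp: d1_def d2_def)
  have tangent_graphs: "\<not> lipschitz_normally_embedded_at (mixed_pb_surface a1 a2 b1 b2) 0"
    if "a2 \<ge> 2" "d2 < d1"
    using not_lipschitz_normally_embedded_if_several_sheets[of snd fst a2 b2 a1 b1] that
    by (simp add: mixed_pb_surface_def mixed_pb_def d1_def d2_def add.commute)
  have tangent_sheets: "\<not> lipschitz_normally_embedded_at (mixed_pb_surface a1 a2 b1 b2) 0"
    if "a1 \<ge> 2" "d1 < d2"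
    using not_lipschitz_normally_embedded_if_several_sheets[of fst snd a1 b1 a2 b2] that
    by (simp add: mixed_pb_surface_def mixed_pb_def d1_def d2_def)
  \<comment> \<open>The weight of the first coordinate has the parity of \<open>a1\<close>.\<close>
  have "a1 \<ge> 2" if "a1 \<ge> 1" "even (a1 + 2 * b1)" using that by (cases "a1 = 1") auto
  thus ?thesis
    using cone horns graph tangent_graphs tangent_sheets d
    unfolding pb_type1_def pb_type2_def pb_type3_def pb_type4_def pb_type5_def \<mu>
    by (auto simp: field_simps)
qed

end
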